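(* Let $k_i:=|\{v\in \mathcal{B}: w(v)=i/e^{*}\}|$ for $0\le i\le ne^{*}$. Then the Hodge polygon $HP(\Delta(\bar{F}))$ is the lower convex polygon (convex closure) of $(0,0)$ and the points $$\left(\sum_{i=0}^{m}k_i,\ \sum_{i=0}^{m}\frac{ik_i}{e^{*}}\right),\quad m=0,1,\dots,ne^{*}.$$
   Context: Let $p>2$ be a prime, $q$ a power of $p$, $n\ge 1$ an integer, $a_1,\dots,a_n,d_1,\dots,d_n$ positive integers not divisible by $p$, and $\bar\lambda\in\mathbb{F}_q^{*}$. Put $$\bar F=\bar F(\bar\lambda,x)=\sum_{i=1}^n x_i^{a_i}+\bar\lambda\prod_{i=1}^n x_i^{-d_i}.$$ Weight. $\Delta(\bar F)\subset\mathbb{R}^n$ is the convex hull of the origin and the exponent vectors of $\bar F$. For $v\in\mathbb{Z}^n$, $w(v)$ is the least nonnegative rational number such that $v\in w(v)\Delta(\bar F)$. Let $e^{*}=\mathrm{lcm}(a_1,d_1)$ if $n=1$, and $e^{*}=\mathrm{lcm}(a_1,\dots,a_n)\cdot\mathrm{lcm}(d_1,\dots,d_n)$ if $n\ge2$; one has $w(\mathbb{Z}^n)\subset\frac1{e^{*}}\mathbb{Z}_{\ge0}$. The set $\mathcal{B}$. If $n=1$, $\mathcal{B}=\{v\in\mathbb{Z}:-d_1<v\le a_1\}$. If $n\ge2$, $\mathcal{B}$ is the set of $(v_1,\dots,v_n)\in\mathbb{Z}^n$ with $-d_i<v_i\le a_i$ for all $1\le i\le n$ and $\frac{d_j}{d_i}(v_i-a_i)\le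 v_j<\frac{d_j}{d_i}v_i+a_j$ for all $1\le i<j\le n$. Hodge polygon. Filter $R=\mathbb{F}_q[x_1^{\pm},\dots,x_n^{\pm}]$ by weight: $R_{i/e^{*}}$ consists of the Laurent polynomials all of whose monomials $x^v$ satisfy $w(v)\le i/e^{*}$. Let $\bar R=\bigoplus_{i\in(1/e^{*})\mathbb{Z}_{\ge0}}\bar R_i$ be the associated graded ring; $\bar R_i$ has as $\mathbb{F}_q$-basis the monomials $x^v$ with $w(v)=i$, and multiplication is $x^ux^{u'}=x^{u+u'}$ if $u,u'$ are cofacial (i.e. $w(u+u')=w(u)+w(u')$; equivalently $u/w(u)$ and $u'/w(u')$ lie on a common closed proper face of $\Delta(\bar F)$, $0$ being cofacial to everything), and $x^ux^{u'}=0$ otherwise. The elements $x_l\frac{\partial\bar F}{\partial x_l}$ lie in $\bar R_1$. For $i\in(1/e^{*})\mathbb{Z}_{\ge0}$ choose an $\mathbb{F}_q$-subspace $V_i$ of $\bar R_i$ spanned by monomials of weight $i$ with $\bar R_i=V_i\oplus\sum_{l=1}^nx_l\frac{\partial\bar F}{\partial x_l}\bar R_{i-1}$ (with $\bar R_{j}=0$ for $j<0$), and put $H_{\Delta}(k)=\dim_{\mathbb{F}_q}V_{k/e^{*}}$ for integers $k\ge0$. The Hodge polygon $HP(\Delta(\bar F))$ is the lower convex polygon in $\mathbb{R}^2$ with vertices $(0,0)$ and $\big(\sum_{k=0}^mH_\Delta(k),\sum_{k=0}^m\frac{k}{e^{*}}H_\Delta(k)\big)$, $m=0,1,\dots,ne^{*}$.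 *)

theory Defs
  imports "HOL-Analysis.Analysis" "HOL-Library.Poly_Mapping"
begin

text \<open>Laurent polynomials in the variables indexed by \<open>'n\<close> are the finitely supported functions
  from exponent vectors to coefficients, with convolution as product. The order on the index
  type \<open>'n\<close> is used only to make sense of \<open>i < j\<close> for the indices of the variables.\<close>

type_synonym ('n, 'k) laurent = "(int ^ 'n) \<Rightarrow>\<^sub>0 'k"

abbreviation monom :: "int ^ 'n::finite \<Rightarrow> ('n, 'k::field) laurent" where
  "monom v \<equiv> Poly_Mapping.single v 1"

definition lscale :: "'k::field \<Rightarrow> ('n::finite, 'k) laurent \<Rightarrow> ('n, 'k) laurent" where
  "lscale c g = Poly_Mapping.single 0 c * g"

global_interpretation laurent: vector_space "lscale :: 'k::field \<Rightarrow> ('n::finite, 'k) laurent \<Rightarrow> _"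
  by unfold_locales
    (simp_all add: lscale_def algebra_simps single_add mult_single flip: mult.assoc)

text \<open>The operator \<open>x\<^sub>l \<partial>/\<partial>x\<^sub>l\<close>.\<close>

definition euler_deriv :: "'n::finite \<Rightarrow> ('n, 'k::field) laurent \<Rightarrow> ('n, 'k) laurent" where
  "euler_deriv l f =
     (\<Sum>v\<in>Poly_Mapping.keys f. Poly_Mapping.single v (of_int (v $ l) * Poly_Mapping.lookup f v))"

definition real_vec :: "int ^ 'n \<Rightarrow> real ^ 'n::finite" where
  "real_vec v = (\<chi> i. real_of_int (v $ i))"

definition newton_polytope :: "('n::finite, 'k::field) laurent \<Rightarrow> (real ^ 'n) set" where
  "newton_polytope f = convex hull (insert 0 (real_vec ` Poly_Mapping.keys f))"

definition weight :: "('n::finite, 'k::field) laurent \<Rightarrow> int ^ 'n \<Rightarrow> real" where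
  "weight f v =
     (LEAST r. r \<in> \<rat> \<and> 0 \<le> r \<and> real_vec v \<in> (\<lambda>x. r *\<^sub>R x) ` newton_polytope f)"

text \<open>The associated graded ring of the weight filtration is modelled on the Laurent polynomials
  themselves: the class of a monomial of weight \<open>i\<close> in the degree \<open>i\<close> piece is represented by
  that monomial. Only the product changes; it keeps the products of cofacial monomials and
  kills all others. As weights are nonnegative, \<open>gr_piece f i\<close> is zero for \<open>i < 0\<close>.\<close>

definition gr_piece :: "('n::finite, 'k::field) laurent \<Rightarrow> real \<Rightarrow> ('n, 'k) laurent set" where
  "gr_piece f i = {g. \<forall>v\<in>Poly_Mapping.keys g. weight f v = i}"

definition gr_mult ::
  "('n::finite, 'k::field) laurent \<Rightarrow> ('n, 'k) laurent \<Rightarrow> ('n, 'k) laurent \<Rightarrow> ('n, 'k) laurent" where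
  "gr_mult f g h =
     (\<Sum>u\<in>Poly_Mapping.keys g. \<Sum>v\<in>Poly_Mapping.keys h.
        if weight f (u + v) = weight f u + weight f v
        then Poly_Mapping.single (u + v) (Poly_Mapping.lookup g u * Poly_Mapping.lookup h v)
        else 0)"

text \<open>The degree \<open>i\<close> piece of the ideal generated by the \<open>x\<^sub>l \<partial>f/\<partial>x\<^sub>l\<close>, all of degree 1.\<close>

definition gr_jacobian :: "('n::finite, 'k::field) laurent \<Rightarrow> real \<Rightarrow> ('n, 'k) laurent set" where
  "gr_jacobian f i =
     {\<Sum>l\<in>UNIV. gr_mult f (euler_deriv l f) (g l) | g. \<forall>l. g l \<in> gr_piece f (i - 1)}"

definition monomial_complement ::
  "('n::finite, 'k::field) laurent \<Rightarrow> real \<Rightarrow> ('n, 'k) laurent set \<Rightarrow> bool" where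
  "monomial_complement f i V \<longleftrightarrow>
     (\<exists>S \<subseteq> {v. weight f v = i}. V = laurent.span (monom ` S)) \<and>
     gr_piece f i = {x + y | x y. x \<in> V \<and> y \<in> gr_jacobian f i} \<and>
     V \<inter> gr_jacobian f i = {0}"

text \<open>The lower boundary of the convex hull of a set of points in the plane.\<close>

definition lower_convex_polygon :: "(real \<times> real) set \<Rightarrow> (real \<times> real) set" where
  "lower_convex_polygon P =
     {(x, y). (x, y) \<in> convex hull P \<and> (\<forall>y'. (x, y') \<in> convex hull P \<longrightarrow> y \<le> y')}"

text \<open>Here \<open>e\<close> is a common denominator of the weights and \<open>V k\<close> is the chosen monomial
  complement in degree \<open>k / e\<close>.\<close>

definition hodge_number :: "(nat \<Rightarrow> ('n::finite, 'k::field) laurent set) \<Rightarrow> nat \<Rightarrow> nat" where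
  "hodge_number V k = laurent.dim (V k)"

definition hodge_polygon ::
  "nat \<Rightarrow> (nat \<Rightarrow> ('n::finite, 'k::field) laurent set) \<Rightarrow> (real \<times> real) set" where
  "hodge_polygon e V = lower_convex_polygon
     (insert (0, 0)
       ((\<lambda>m. (\<Sum>k\<le>m. real (hodge_number V k),
              \<Sum>k\<le>m. real k / real e * real (hodge_number V k))) ` {..CARD('n) * e}))"

definition Fbar :: "('n::finite \<Rightarrow> nat) \<Rightarrow> ('n \<Rightarrow> nat) \<Rightarrow> 'k::field \<Rightarrow> ('n, 'k) laurent" where
  "Fbar a d c =
     (\<Sum>i\<in>UNIV. monom (axis i (int (a i)))) + Poly_Mapping.single (\<chi> i. - int (d i)) c"

definition estar :: "('n::finite \<Rightarrow> nat) \<Rightarrow> ('n \<Rightarrow> nat) \<Rightarrow> nat" where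
  "estar a d =
     (if CARD('n) = 1 then lcm (Lcm (range a)) (Lcm (range d)) else Lcm (range a) * Lcm (range d))"

text \<open>For one variable there are no \<open>i < j\<close>, and the second condition is void.\<close>

definition Bset ::
  "('n::{finite,linorder} \<Rightarrow> nat) \<Rightarrow> ('n \<Rightarrow> nat) \<Rightarrow> (int ^ ('n::{finite,linorder})) set" where
  "Bset a d =
     {v. (\<forall>i. - int (d i) < v $ i \<and> v $ i \<le> int (a i)) \<and>
         (\<forall>i j. i < j \<longrightarrow>
            real (d j) / real (d i) * (real_of_int (v $ i) - real (a i)) \<le> real_of_int (v $ j) \<and>
            real_of_int (v $ j) < real (d j) / real (d i) * real_of_int (v $ i) + real (a j))}"

end

theory Submission
  imports Defs
begin

text \<open>The Newton polytope is a simplex with \<open>0\<close> in its interior, so a lattice point has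
  unique nonnegative coordinates with respect to the \<open>n + 1\<close> vertices with at least one coordinate
  zero, and its weight is their sum. Write \<open>X\<^sub>j\<close> for the monomial at the vertex \<open>j\<close>. Sorting lattice
  points by the vector \<open>\<phi>\<close> of fractional parts of their coordinates splits the graded ring into pieces
  \<open>k[X\<^sub>0, \<dots>, X\<^sub>n] / (\<Prod>j\<in>Z. X\<^sub>j)\<close>, where \<open>Z\<close> is the set of zeros of \<open>\<phi>\<close>. The Jacobian ideal
  identifies each \<open>X\<^sub>j\<close> with a nonzero multiple of \<open>X\<^sub>0\<close>, which leaves \<open>k[T] / (T ^ card Z)\<close>.
  The points of \<open>Bset a d\<close> over \<open>\<phi>\<close> are the sums of \<open>\<phi>\<close> and the indicator functions of the proper initial
  segments of \<open>Z\<close>, one in each of the degrees \<open>0, \<dots>, card Z - 1\<close>. So in every weight their monomials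
  form a basis of the quotient.\<close>

section \<open>Linear maps on Laurent polynomials\<close>

text \<open>\<open>h\<close> carries \<open>V\<close> isomorphically onto \<open>W\<close>: it
  discards the component in \<open>J\<close> and keeps the component in \<open>W\<close>. An
  explicit isomorphism avoids subtracting dimensions in a space of infinite dimension.\<close>

lemma (in vector_space) dim_complement_eq:
  assumes lin: "Vector_Spaces.linear scale scale h"
    and sub: "subspace V" "subspace W" "subspace J"
    and disj: "V \<inter> J \<subseteq> {0}"
    and kills: "\<And>y. y \<in> J \<Longrightarrow> h y = 0"
    and fixes_W: "\<And>x. x \<in> W \<Longrightarrow> h x = x"
    and sums: "{x + y | x y. x \<in> V \<and> y \<in> J} = {x + y | x y. x \<in> W \<and> y \<in> J}"
  shows "dim V = dim W"
proof -
  interpret h: Vector_Spaces.linear scale scale h by (rule lin)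
  have V_dec: "\<exists>w y. w \<in> W \<and> y \<in> J \<and> x = w + y" if "x \<in> V" for x
    using sums that subspace_0[OF sub(3)] by (smt (verit) add.right_neutral mem_Collect_eq)
  have W_dec: "\<exists>x y. x \<in> V \<and> y \<in> J \<and> w = x + y" if "w \<in> W" for w
    using sums that subspace_0[OF sub(3)] by (smt (verit) add.right_neutral mem_Collect_eq)
  have hV: "h ` V = W"
  proof (intro equalityI subsetI)
    fix z assume "z \<in> h ` V"
    then show "z \<in> W"
      using V_dec fixes_W kills by (force simp: h.add)
  next
    fix w assume "w \<in> W"
    then obtain x y where "x \<in> V" "y \<in> J" "w = x + y"
      using W_dec by blast
    moreover have "h x = w"
      using calculation fixes_W[OF \<open>w \<in> W\<close>] kills by (simp add: h.add)
    ultimately show "w \<in> h ` V" by force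
  qed
  have inj: "inj_on h V"
  proof -
    \<comment> \<open>Applying \<open>h\<close> to \<open>x = w + y\<close> gives
      \<open>w = 0\<close>, so \<open>x\<close> lies in both \<open>V\<close> and
      \<open>J\<close>.\<close>
    have "x = 0" if "x \<in> V" "h x = 0" for x
    proof -
      obtain w y where "w \<in> W" "y \<in> J" "x = w + y"
        using V_dec \<open>x \<in> V\<close> by blast
      then have "x \<in> J"
        using that(2) fixes_W kills by (simp add: h.add)
      then show ?thesis using disj that(1) by blast
    qed
    then show ?thesis
      using sub(1) by (simp add: h.inj_on_iff_eq_0)
  qed
  obtain T where T: "T \<subseteq> V" "independent T" "V \<subseteq> span T" "card T = dim V"
    using basis_exists by blast
  then have spanT: "span T = V"
    using sub(1) by (metis span_subspace)
  have "span (h ` T) = W"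
    using h.span_image spanT hV by simp
  moreover have "independent (h ` T)"
    using h.dependent_inj_imageD[of T] T(2) inj by (metis spanT)
  ultimately have "dim W = card (h ` T)"
    by (metis dim_span_eq_card_independent)
  also have "\<dots> = card T"
    using inj T(1) by (meson card_image inj_on_subset)
  finally show ?thesis using T(4) by simp
qed

section \<open>Linear extension from monomials, and spans of monomials\<close>

lemma lookup_lscale [simp]: "Poly_Mapping.lookup (lscale c g) v = c * Poly_Mapping.lookup g v"
  unfolding lscale_def mult_map_scale_conv_mult[symmetric]
  by (auto simp: Poly_Mapping.map.rep_eq when_def)

lemma lscale_single [simp]: "lscale c (Poly_Mapping.single v b) = Poly_Mapping.single v (c * b)"
  by (simp add: lscale_def mult_single)

definition linear_ext ::
  "(int ^ 'n::finite \<Rightarrow> ('n, 'k::field) laurent) \<Rightarrow> ('n, 'k) laurent \<Rightarrow> ('n, 'k) laurent" where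
  "linear_ext F h = (\<Sum>v\<in>Poly_Mapping.keys h. lscale (Poly_Mapping.lookup h v) (F v))"

lemma linear_ext_superset:
  assumes "finite A" "Poly_Mapping.keys h \<subseteq> A"
  shows "linear_ext F h = (\<Sum>v\<in>A. lscale (Poly_Mapping.lookup h v) (F v))"
  unfolding linear_ext_def
  by (rule sum.mono_neutral_left) (use assms in \<open>auto simp: in_keys_iff\<close>)

lemma linear_linear_ext: "Vector_Spaces.linear lscale lscale (linear_ext F)"
proof -
  have "linear_ext F (g + h) = linear_ext F g + linear_ext F h" for g h
  proof -
    let ?A = "Poly_Mapping.keys g \<union> Poly_Mapping.keys h"
    have "Poly_Mapping.keys (g + h) \<subseteq> ?A" by (rule keys_add)
    then show ?thesis
      by (simp add: linear_ext_superset[where A = ?A] lookup_add laurent.scale_left_distrib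
          sum.distrib)
  qed
  moreover have "linear_ext F (lscale c h) = lscale c (linear_ext F h)" for c h
  proof -
    have "Poly_Mapping.keys (lscale c h) \<subseteq> Poly_Mapping.keys h"
      by (auto simp: in_keys_iff)
    then show ?thesis
      by (simp add: linear_ext_superset[where A = "Poly_Mapping.keys h"] laurent.scale_sum_right)
  qed
  ultimately show ?thesis
    unfolding Vector_Spaces.linear_iff using laurent.vector_space_axioms by blast
qed

lemma linear_ext_single [simp]: "linear_ext F (Poly_Mapping.single v c) = lscale c (F v)"
  by (cases "c = 0") (simp_all add: linear_ext_def)

lemmas linear_ext_add = module_hom.add[OF linear_linear_ext[unfolded linear_iff_module_hom]]
  and linear_ext_scale = module_hom.scale[OF linear_linear_ext[unfolded linear_iff_module_hom]]
  and linear_ext_0 [simp] = module_hom.zero[OF linear_linear_ext[unfolded linear_iff_module_hom]]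

lemma linear_ext_add_fun: "linear_ext (\<lambda>v. F v + G v) h = linear_ext F h + linear_ext G h"
  by (simp add: linear_ext_def laurent.scale_right_distrib sum.distrib)

lemma linear_ext_scale_fun: "linear_ext (\<lambda>v. lscale c (F v)) h = lscale c (linear_ext F h)"
  by (simp add: linear_ext_def laurent.scale_sum_right mult.commute)

lemma linear_ext_monom: "linear_ext monom h = h"
proof (rule poly_mapping_eqI)
  fix v
  have "Poly_Mapping.lookup (linear_ext monom h) v =
      (\<Sum>u\<in>Poly_Mapping.keys h. Poly_Mapping.lookup h u when u = v)"
    by (simp add: linear_ext_def lookup_sum lookup_single)
  also have "\<dots> = Poly_Mapping.lookup h v"
    by (cases "v \<in> Poly_Mapping.keys h") (auto simp: when_def sum.delta in_keys_iff)
  finally show "Poly_Mapping.lookup (linear_ext monom h) v = Poly_Mapping.lookup h v" .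
qed

lemma linear_eq_linear_ext:
  assumes "Vector_Spaces.linear lscale lscale L"
  shows "L h = linear_ext (\<lambda>v. L (monom v)) h"
proof -
  interpret L: Vector_Spaces.linear lscale lscale L by fact
  have "L (linear_ext monom h) = linear_ext (\<lambda>v. L (monom v)) h"
    unfolding linear_ext_def L.sum L.scale ..
  then show ?thesis by (simp only: linear_ext_monom)
qed

lemma linear_ext_mem_subspace:
  assumes "laurent.subspace S" "\<And>v. v \<in> Poly_Mapping.keys h \<Longrightarrow> G v \<in> S"
  shows "linear_ext G h \<in> S"
  unfolding linear_ext_def
  by (intro laurent.subspace_sum laurent.subspace_scale assms) auto

lemma monomial_span_mem_iff: "g \<in> laurent.span (monom ` A) \<longleftrightarrow> Poly_Mapping.keys g \<subseteq> A"
proof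
  assume "g \<in> laurent.span (monom ` A)"
  then show "Poly_Mapping.keys g \<subseteq> A"
  proof (induction rule: laurent.span_induct_alt)
    case base
    then show ?case by simp
  next
    case (step c x y)
    then obtain v where "v \<in> A" "x = monom v" by blast
    then show ?case
      using step(2) keys_add[of "lscale c x" y] by (auto split: if_splits)
  qed
next
  assume "Poly_Mapping.keys g \<subseteq> A"
  then have "linear_ext monom g \<in> laurent.span (monom ` A)"
    unfolding linear_ext_def
    by (intro laurent.span_sum laurent.span_scale laurent.span_base) auto
  then show "g \<in> laurent.span (monom ` A)"
    by (simp only: linear_ext_monom)
qed

lemma dim_monomial_span:
  "laurent.dim (laurent.span ((monom :: _ \<Rightarrow> ('n::finite, 'k::field) laurent) ` A)) = card A"
proof -
  let ?m = "monom :: int ^ 'n \<Rightarrow> ('n, 'k) laurent"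
  have inj: "inj ?m"
    by (rule injI) (metis lookup_single_eq lookup_single_not_eq zero_neq_one)
  have "?m v \<notin> laurent.span (?m ` A - {?m v})" for v
  proof -
    have "?m ` A - {?m v} = ?m ` (A - {v})"
      using inj by (auto simp: inj_def)
    then show ?thesis by (simp add: monomial_span_mem_iff)
  qed
  then have "laurent.independent (?m ` A)"
    unfolding laurent.dependent_def by blast
  then show ?thesis
    using inj by (simp add: laurent.dim_eq_card_independent card_image inj_on_subset)
qed

section \<open>Graded pieces, the graded product and the Jacobian ideal\<close>

lemma gr_piece_eq_span: "gr_piece f i = laurent.span (monom ` {v. weight f v = i})"
  by (auto simp: gr_piece_def monomial_span_mem_iff)

lemma subspace_gr_piece: "laurent.subspace (gr_piece f i)"
  by (simp add: gr_piece_eq_span)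

text \<open>Bilinearity of the graded product is read off from this form.\<close>

lemma gr_mult_eq_linear_ext:
  "gr_mult f g h = linear_ext (\<lambda>u. linear_ext
     (\<lambda>v. if weight f (u + v) = weight f u + weight f v then monom (u + v) else 0) h) g"
  unfolding gr_mult_def linear_ext_def laurent.scale_sum_right
  by (intro sum.cong refl) auto

lemma gr_mult_add_right: "gr_mult f g (h + h') = gr_mult f g h + gr_mult f g h'"
  by (simp add: gr_mult_eq_linear_ext linear_ext_add linear_ext_add_fun)

lemma gr_mult_scale_right: "gr_mult f g (lscale c h) = lscale c (gr_mult f g h)"
  by (simp add: gr_mult_eq_linear_ext linear_ext_scale linear_ext_scale_fun)

lemma gr_mult_0_right [simp]: "gr_mult f g 0 = 0"
  by (simp add: gr_mult_def)

lemma subspace_gr_jacobian: "laurent.subspace (gr_jacobian f i)"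
proof (rule laurent.subspaceI)
  have "(\<Sum>l\<in>UNIV. gr_mult f (euler_deriv l f) 0) \<in> gr_jacobian f i"
    unfolding gr_jacobian_def by (rule CollectI, rule exI[of _ "\<lambda>_. 0"]) (simp add: gr_piece_def)
  then show "0 \<in> gr_jacobian f i" by simp
next
  fix x y assume "x \<in> gr_jacobian f i" "y \<in> gr_jacobian f i"
  then obtain g h where gh: "\<forall>l. g l \<in> gr_piece f (i - 1)" "\<forall>l. h l \<in> gr_piece f (i - 1)"
    "x = (\<Sum>l\<in>UNIV. gr_mult f (euler_deriv l f) (g l))"
    "y = (\<Sum>l\<in>UNIV. gr_mult f (euler_deriv l f) (h l))"
    unfolding gr_jacobian_def by blast
  then show "x + y \<in> gr_jacobian f i"
    unfolding gr_jacobian_def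
    by (intro CollectI exI[of _ "\<lambda>l. g l + h l"])
      (simp add: gr_mult_add_right sum.distrib laurent.subspace_add subspace_gr_piece)
next
  fix c x assume "x \<in> gr_jacobian f i"
  then obtain g where g: "\<forall>l. g l \<in> gr_piece f (i - 1)"
    "x = (\<Sum>l\<in>UNIV. gr_mult f (euler_deriv l f) (g l))"
    unfolding gr_jacobian_def by blast
  then show "lscale c x \<in> gr_jacobian f i"
    unfolding gr_jacobian_def
    by (intro CollectI exI[of _ "\<lambda>l. lscale c (g l)"])
      (simp add: gr_mult_scale_right laurent.scale_sum_right laurent.subspace_scale
        subspace_gr_piece)
qed

lemma gr_mult_euler_deriv_in_gr_jacobian:
  assumes "h \<in> gr_piece f (i - 1)"
  shows "gr_mult f (euler_deriv l f) h \<in> gr_jacobian f i"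
proof -
  have "(\<Sum>l'\<in>UNIV. gr_mult f (euler_deriv l' f) (if l' = l then h else 0)) =
      gr_mult f (euler_deriv l f) h"
    by (simp add: if_distrib sum.delta cong: if_cong)
  then show ?thesis
    unfolding gr_jacobian_def using assms
    by (intro CollectI exI[of _ "\<lambda>l'. if l' = l then h else 0"]) (auto simp: gr_piece_def)
qed

section \<open>Weights\<close>

definition vertex :: "('n::finite \<Rightarrow> nat) \<Rightarrow> ('n \<Rightarrow> nat) \<Rightarrow> 'n option \<Rightarrow> int ^ 'n" where
  "vertex a d j = (case j of None \<Rightarrow> (\<chi> i. - int (d i)) | Some i \<Rightarrow> axis i (int (a i)))"

definition lattice_comb ::
  "('n::finite \<Rightarrow> nat) \<Rightarrow> ('n \<Rightarrow> nat) \<Rightarrow> ('n option \<Rightarrow> int) \<Rightarrow> int ^ 'n" where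
  "lattice_comb a d m = (\<Sum>j\<in>UNIV. m j *s vertex a d j)"

text \<open>\<open>vertex None + (\<Sum>i. relation_coeff (Some i) * vertex (Some i)) = 0\<close> is the linear relation
  between the vertices.\<close>

definition relation_coeff :: "('n \<Rightarrow> nat) \<Rightarrow> ('n \<Rightarrow> nat) \<Rightarrow> 'n option \<Rightarrow> real" where
  "relation_coeff a d j = (case j of None \<Rightarrow> 1 | Some i \<Rightarrow> real (d i) / real (a i))"

text \<open>Writing \<open>x\<close> in the vertices \<open>Some i\<close> alone and dividing the
  coefficients by \<open>relation_coeff\<close> gives these numbers. Adding a multiple of the linear
  relation to the coefficients shifts all of them, including the one at \<open>None\<close>, by the
  same constant.\<close>

definition slope :: "('n \<Rightarrow> nat) \<Rightarrow> real ^ 'n \<Rightarrow> 'n option \<Rightarrow> real" where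
  "slope d x j = (case j of None \<Rightarrow> 0 | Some i \<Rightarrow> x $ i / real (d i))"

text \<open>Shifting the slopes by this amount makes the least of them zero, so all coordinates
  become nonnegative and at least one vanishes.\<close>

definition min_slope :: "('n::finite \<Rightarrow> nat) \<Rightarrow> int ^ 'n \<Rightarrow> real" where
  "min_slope d v = Min (range (slope d (real_vec v)))"

text \<open>The nonnegative coordinates of \<open>v\<close> with respect to the vertices of a face that
  spans a cone containing \<open>v\<close>, extended by zero.\<close>

definition coord ::
  "('n::finite \<Rightarrow> nat) \<Rightarrow> ('n \<Rightarrow> nat) \<Rightarrow> int ^ 'n \<Rightarrow> 'n option \<Rightarrow> real" where
  "coord a d v j = relation_coeff a d j * (slope d (real_vec v) j - min_slope d v)"

lemma sum_option_UNIV: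
  fixes F :: "'n::finite option \<Rightarrow> 'b::comm_monoid_add"
  shows "(\<Sum>j\<in>UNIV. F j) = F None + (\<Sum>i\<in>UNIV. F (Some i))"
  by (simp add: UNIV_option_conv sum.reindex)

locale weight_simplex =
  fixes a d :: "'n::finite \<Rightarrow> nat"
  assumes a_pos: "a i > 0" and d_pos: "d i > 0"
begin

abbreviation "vtx \<equiv> vertex a d"
abbreviation "comb \<equiv> lattice_comb a d"
abbreviation "\<rho> \<equiv> relation_coeff a d"
abbreviation "co \<equiv> coord a d"

definition basis_fun :: "'n option \<Rightarrow> 'n option \<Rightarrow> int" where
  "basis_fun l j = (if j = l then 1 else 0)"

lemma relation_coeff_pos: "\<rho> j > 0"
  using a_pos d_pos by (auto simp: relation_coeff_def split: option.split)

lemma real_vec_comb: "real_vec (comb m) $ i = m (Some i) * real (a i) - m None * real (d i)"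
proof -
  have "comb m $ i = m None * (- int (d i)) + (\<Sum>i'\<in>UNIV. m (Some i') * (if i' = i then int (a i') else 0))"
    unfolding lattice_comb_def sum_option_UNIV
    by (simp add: vertex_def axis_def if_distrib cong: if_cong)
  also have "\<dots> = m (Some i) * int (a i) - m None * int (d i)"
    by (simp add: if_distrib sum.delta cong: if_cong)
  finally show ?thesis by (simp add: real_vec_def)
qed

lemma slope_add: "slope d (x + y) j = slope d x j + slope d y j"
  by (simp add: slope_def add_divide_distrib split: option.split)

lemma slope_real_vec_comb:
  "slope d (real_vec (comb m)) j = m j / \<rho> j - m None"
proof -
  have "slope d (real_vec (comb m)) (Some i) = m (Some i) / \<rho> (Some i) - m None" for i
    using a_pos[of i] d_pos[of i]
    by (simp add: slope_def real_vec_comb relation_coeff_def field_simps)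
  then show ?thesis by (cases j) (simp_all add: slope_def relation_coeff_def)
qed

lemma coord_nonneg: "0 \<le> co v j"
  unfolding coord_def min_slope_def using relation_coeff_pos[of j] by simp

lemma coord_zero: "\<exists>j. co v j = 0"
proof -
  have "min_slope d v \<in> range (slope d (real_vec v))"
    unfolding min_slope_def by (intro Min_in) auto
  then show ?thesis by (auto simp: coord_def)
qed

lemma coord_rational: "co v j \<in> \<rat>"
proof -
  have s: "slope d (real_vec v) j \<in> \<rat>" for j
    by (simp add: slope_def real_vec_def split: option.split)
  have "min_slope d v \<in> range (slope d (real_vec v))"
    unfolding min_slope_def by (intro Min_in) auto
  then have "min_slope d v \<in> \<rat>" using s by auto
  moreover have "\<rho> j \<in> \<rat>"
    by (simp add: relation_coeff_def split: option.split)
  ultimately show ?thesis using s by (simp add: coord_def)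
qed

lemma real_vec_add: "real_vec (u + v) = real_vec u + real_vec v"
  by (simp add: real_vec_def vec_eq_iff)

text \<open>Two expressions of one vector in the vertices differ by a multiple of the linear
  relation; \<open>\<sigma>\<close> is that multiple.\<close>

lemma coord_add_comb_ex: "\<exists>\<sigma>. \<forall>j. co (v + comb m) j = co v j + m j - \<rho> j * \<sigma>"
proof (intro exI allI)
  fix j
  show "co (v + comb m) j =
      co v j + m j - \<rho> j * (min_slope d (v + comb m) - min_slope d v + m None)"
    using relation_coeff_pos[of j]
    by (simp add: coord_def real_vec_add slope_add slope_real_vec_comb algebra_simps)
qed

text \<open>Nonnegative coordinates with a zero among them are unique: a zero of the new coordinates
  forces \<open>\<sigma> \<ge> 0\<close>, and the zero of the candidate at \<open>l\<close> forces
  \<open>\<sigma> \<le> 0\<close>.\<close>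

lemma coord_add_comb:
  assumes "\<And>j. co v j + m j \<ge> 0" and "co v l + m l = 0"
  shows "co (v + comb m) j = co v j + m j"
proof -
  obtain \<sigma> where \<sigma>: "\<And>j. co (v + comb m) j = co v j + m j - \<rho> j * \<sigma>"
    using coord_add_comb_ex by blast
  obtain l' where l': "co (v + comb m) l' = 0" using coord_zero by blast
  have "\<rho> l' * \<sigma> \<ge> 0" using \<sigma>[of l'] l' assms(1)[of l'] by simp
  moreover have "\<rho> l * \<sigma> \<le> 0"
    using \<sigma>[of l] assms(2) coord_nonneg[of "v + comb m" l] by simp
  ultimately have "\<sigma> = 0"
    using relation_coeff_pos[of l] relation_coeff_pos[of l']
    by (simp add: zero_le_mult_iff mult_le_0_iff)
  then show ?thesis using \<sigma> by simp
qed

lemma comb_basis_fun: "comb (basis_fun l) = vtx l"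
proof -
  have "comb (basis_fun l) = (\<Sum>j\<in>UNIV. if j = l then vtx j else 0)"
    unfolding lattice_comb_def basis_fun_def by (intro sum.cong) auto
  then show ?thesis by simp
qed

lemma comb_add: "comb (\<lambda>j. m j + m' j) = comb m + comb m'"
  unfolding lattice_comb_def by (simp only: vector_sadd_rdistrib sum.distrib)

lemma comb_uminus: "comb (\<lambda>j. - m j) = - comb m"
  unfolding lattice_comb_def by (simp only: vector_smult_lneg sum_negf)

lemma coord_0: "co 0 j = 0"
proof -
  have "slope d (real_vec (0 :: int ^ 'n)) = (\<lambda>_. 0)"
    by (auto simp: slope_def real_vec_def split: option.split)
  then show ?thesis by (simp add: coord_def min_slope_def)
qed

lemma ex_option_neq: "\<exists>i. i \<noteq> (l :: 'n option)"
  by (cases l) auto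

lemma coord_add_vertex:
  assumes "i \<noteq> l" "co v i = 0"
  shows "co (v + vtx l) j = co v j + (if j = l then 1 else 0)"
proof -
  have "co (v + comb (basis_fun l)) j = co v j + real_of_int (basis_fun l j)"
    by (rule coord_add_comb[where l = i]) (use assms coord_nonneg in \<open>auto simp: basis_fun_def\<close>)
  then show ?thesis by (simp add: comb_basis_fun basis_fun_def)
qed

lemma coord_vertex: "co (vtx l) j = (if j = l then 1 else 0)"
proof -
  obtain i where "i \<noteq> l" using ex_option_neq by blast
  then show ?thesis using coord_add_vertex[of i l 0 j] coord_0 by simp
qed

text \<open>This is cofaciality with a vertex. Without a zero away from \<open>l\<close>, adding the
  vertex makes all coefficients positive; a positive multiple of the relation must then be
  subtracted, and the sum grows by less than 1.\<close>

lemma sum_coord_add_vertex_eq_iff: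
  "(\<Sum>j\<in>UNIV. co (v + vtx l) j) = (\<Sum>j\<in>UNIV. co v j) + 1 \<longleftrightarrow> (\<exists>i. i \<noteq> l \<and> co v i = 0)"
proof
  assume "\<exists>i. i \<noteq> l \<and> co v i = 0"
  then show "(\<Sum>j\<in>UNIV. co (v + vtx l) j) = (\<Sum>j\<in>UNIV. co v j) + 1"
    by (auto simp: coord_add_vertex sum.distrib)
next
  assume eq: "(\<Sum>j\<in>UNIV. co (v + vtx l) j) = (\<Sum>j\<in>UNIV. co v j) + 1"
  show "\<exists>i. i \<noteq> l \<and> co v i = 0"
  proof (rule ccontr)
    assume no_zero: "\<nexists>i. i \<noteq> l \<and> co v i = 0"
    obtain \<sigma> where "\<And>j. co (v + comb (basis_fun l)) j = co v j + basis_fun l j - \<rho> j * \<sigma>"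
      using coord_add_comb_ex by blast
    then have \<sigma>: "co (v + vtx l) j = co v j + (if j = l then 1 else 0) - \<rho> j * \<sigma>" for j
      by (auto simp: comb_basis_fun basis_fun_def)
    obtain i where i: "co (v + vtx l) i = 0" using coord_zero by blast
    have "co v i + (if i = l then 1 else 0) > 0"
      using no_zero coord_nonneg[of v i] by (cases "i = l") (auto simp: less_le)
    then have "\<rho> i * \<sigma> > 0" using \<sigma>[of i] i by simp
    then have "\<sigma> > 0" using relation_coeff_pos[of i] by (simp add: zero_less_mult_iff)
    have "(\<Sum>j\<in>UNIV. co (v + vtx l) j) = (\<Sum>j\<in>UNIV. co v j) + 1 - (\<Sum>j\<in>UNIV. \<rho> j) * \<sigma>"
      by (simp add: \<sigma> sum.distrib sum_subtractf sum_distrib_right)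
    moreover have "(\<Sum>j\<in>UNIV. \<rho> j) > 0"
      using relation_coeff_pos by (intro sum_pos) auto
    ultimately show False using eq \<open>\<sigma> > 0\<close> by simp
  qed
qed

lemma vertex_inject: "vtx i = vtx j \<longleftrightarrow> i = j"
  by (metis coord_vertex zero_neq_one)

section \<open>The coordinate sum as the least scaling of the simplex\<close>

lemma real_vec_eq_sum_coord: "real_vec v = (\<Sum>j\<in>UNIV. co v j *\<^sub>R real_vec (vtx j))"
proof (subst vec_eq_iff, intro allI)
  fix i
  have "(\<Sum>j\<in>UNIV. co v j *\<^sub>R real_vec (vtx j)) $ i =
      co v None * - real (d i) + (\<Sum>i'\<in>UNIV. co v (Some i') * (if i' = i then real (a i') else 0))"
    unfolding sum_option_UNIV
    by (simp add: vertex_def real_vec_def axis_def if_distrib cong: if_cong)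
  also have "\<dots> = co v (Some i) * real (a i) - co v None * real (d i)"
    by (simp add: if_distrib sum.delta cong: if_cong)
  also have "\<dots> = real_vec v $ i"
    using a_pos[of i] d_pos[of i]
    by (simp add: coord_def relation_coeff_def slope_def field_simps)
  finally show "real_vec v $ i = (\<Sum>j\<in>UNIV. co v j *\<^sub>R real_vec (vtx j)) $ i" by simp
qed

lemma slope_scaleR: "slope d (c *\<^sub>R x) j = c * slope d x j"
  by (simp add: slope_def split: option.split)

text \<open>The weight is the maximum over \<open>j\<close> of the linear forms
  \<open>x \<mapsto> \<Sum>i. \<rho> i * (slope x i - slope x j)\<close>, each bounded by 1 on the vertices.\<close>

lemma sum_coord_le_scale:
  assumes "0 \<le> r" and x: "real_vec v = r *\<^sub>R x"
    and hull: "x \<in> convex hull (insert 0 (real_vec ` range vtx))"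
  shows "(\<Sum>j\<in>UNIV. co v j) \<le> r"
proof -
  obtain j where j: "co v j = 0" using coord_zero by blast
  define L where "L y = (\<Sum>i\<in>UNIV. \<rho> i * (slope d y i - slope d y j))" for y
  have lin: "linear L"
  proof (rule linearI)
    show "L (x + y) = L x + L y" for x y
      unfolding L_def slope_add sum.distrib[symmetric] by (intro sum.cong refl) algebra
    show "L (c *\<^sub>R x) = c *\<^sub>R L x" for c x
      unfolding L_def slope_scaleR real_scaleR_def sum_distrib_left by (intro sum.cong refl) algebra
  qed
  have "L (real_vec (vtx l)) \<le> 1" for l
  proof -
    have "\<rho> i * (slope d (real_vec (vtx l)) i - slope d (real_vec (vtx l)) j) =
        (if i = l then 1 else 0) - \<rho> i * (if j = l then 1 / \<rho> j else 0)" for i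
      using relation_coeff_pos[of i]
      by (simp add: slope_real_vec_comb basis_fun_def field_simps flip: comb_basis_fun)
    then have "L (real_vec (vtx l)) = 1 - (\<Sum>i\<in>UNIV. \<rho> i) * (if j = l then 1 / \<rho> j else 0)"
      unfolding L_def by (simp add: sum_subtractf flip: sum_distrib_right)
    then show ?thesis
      using relation_coeff_pos by (simp add: less_imp_le sum_nonneg)
  qed
  moreover have "L 0 = 0" by (rule linear_0[OF lin])
  ultimately have sub: "insert 0 (real_vec ` range vtx) \<subseteq> L -` {..1}"
    by simp blast
  have "convex (L -` {..1})"
    by (rule convex_linear_vimage[OF lin convex_real_interval(2)])
  with sub have "convex hull (insert 0 (real_vec ` range vtx)) \<subseteq> L -` {..1}"
    by (rule hull_minimal)
  with hull have "L x \<le> 1" by blast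
  \<comment> \<open>A zero coordinate at \<open>j\<close> means that \<open>j\<close> attains the
    minimal slope, so \<open>L\<close> is the linear form active at \<open>v\<close>.\<close>
  have "(\<Sum>j\<in>UNIV. co v j) = L (real_vec v)"
    using j relation_coeff_pos[of j] by (simp add: L_def coord_def)
  also have "\<dots> = r * L x"
    by (simp add: x linear_scale[OF lin])
  also have "\<dots> \<le> r" using \<open>L x \<le> 1\<close> \<open>0 \<le> r\<close> by (simp add: mult_left_le)
  finally show ?thesis .
qed

lemma real_vec_in_scaled_hull:
  "real_vec v \<in> (\<lambda>x. (\<Sum>j\<in>UNIV. co v j) *\<^sub>R x) ` (convex hull (insert 0 (real_vec ` range vtx)))"
    (is "_ \<in> _ ` ?H")
proof (cases "(\<Sum>j\<in>UNIV. co v j) = 0")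
  case True
  then have "real_vec v = 0"
    using coord_nonneg by (subst real_vec_eq_sum_coord) (simp add: sum_nonneg_eq_0_iff)
  moreover have "0 \<in> ?H" by (simp add: hull_inc)
  ultimately show ?thesis by force
next
  case False
  let ?s = "\<Sum>j\<in>UNIV. co v j"
  have pos: "?s > 0" using False coord_nonneg by (simp add: less_le sum_nonneg)
  have "(\<Sum>j\<in>UNIV. (co v j / ?s) *\<^sub>R real_vec (vtx j)) \<in> ?H"
    using pos coord_nonneg
    by (intro convex_sum convex_convex_hull) (auto simp: hull_inc simp flip: sum_divide_distrib)
  moreover have "real_vec v = ?s *\<^sub>R (\<Sum>j\<in>UNIV. (co v j / ?s) *\<^sub>R real_vec (vtx j))"
    using pos by (subst real_vec_eq_sum_coord) (simp add: scaleR_sum_right)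
  ultimately show ?thesis by blast
qed

end

section \<open>The graded ring modulo the Jacobian ideal\<close>

text \<open>The ideal identifies \<open>X\<^sub>l\<close> with \<open>ratio l * X\<^sub>0\<close>, where \<open>X\<^sub>0\<close> and \<open>X\<^sub>l\<close> are the
  monomials at the vertices \<open>None\<close> and \<open>Some l\<close>.\<close>

definition ratio ::
  "('n::finite \<Rightarrow> nat) \<Rightarrow> ('n \<Rightarrow> nat) \<Rightarrow> 'k::field \<Rightarrow> 'n option \<Rightarrow> 'k" where
  "ratio a d c j = (case j of None \<Rightarrow> 1 | Some l \<Rightarrow> of_nat (d l) * c / of_nat (a l))"

locale laurent_simplex = weight_simplex a d
  for a d :: "'n::finite \<Rightarrow> nat" +
  fixes lam :: "'k::field"
  assumes lam_nonzero: "lam \<noteq> 0"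
    and of_nat_a: "of_nat (a i) \<noteq> (0 :: 'k)"
    and of_nat_d: "of_nat (d i) \<noteq> (0 :: 'k)"
begin

abbreviation F :: "('n, 'k) laurent" where "F \<equiv> Fbar a d lam"
abbreviation "wt \<equiv> weight F"
abbreviation "\<mu> \<equiv> ratio a d lam"

definition coeff :: "'n option \<Rightarrow> 'k" where
  "coeff j = (case j of None \<Rightarrow> lam | Some _ \<Rightarrow> 1)"

lemma Fbar_eq: "F = (\<Sum>j\<in>UNIV. Poly_Mapping.single (vtx j) (coeff j))"
  unfolding sum_option_UNIV by (simp add: Fbar_def vertex_def coeff_def add.commute)

lemma lookup_Fbar_vertex: "Poly_Mapping.lookup F (vtx j) = coeff j"
proof -
  have "Poly_Mapping.lookup F (vtx j) = (\<Sum>i\<in>UNIV. if i = j then coeff i else 0)"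
    unfolding Fbar_eq lookup_sum
    by (intro sum.cong) (auto simp: lookup_single when_def vertex_inject)
  then show ?thesis by simp
qed

lemma keys_Fbar: "Poly_Mapping.keys F = range vtx"
proof
  show "Poly_Mapping.keys F \<subseteq> range vtx"
    unfolding Fbar_eq by (rule order_trans[OF keys_sum]) auto
  show "range vtx \<subseteq> Poly_Mapping.keys F"
    using lam_nonzero by (auto simp: in_keys_iff lookup_Fbar_vertex coeff_def split: option.split)
qed

text \<open>The least element is taken among rationals, so the coordinate sum has to be rational as
  well as minimal.\<close>

lemma weight_eq: "wt v = (\<Sum>j\<in>UNIV. co v j)"
  unfolding weight_def
proof (rule Least_equality)
  show "(\<Sum>j\<in>UNIV. co v j) \<in> \<rat> \<and> 0 \<le> (\<Sum>j\<in>UNIV. co v j) \<and>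
      real_vec v \<in> (*\<^sub>R) (\<Sum>j\<in>UNIV. co v j) ` newton_polytope F"
    using real_vec_in_scaled_hull[of v]
    by (simp add: newton_polytope_def keys_Fbar coord_rational Rats_sum sum_nonneg coord_nonneg)
next
  fix r :: real
  assume "r \<in> \<rat> \<and> 0 \<le> r \<and> real_vec v \<in> (*\<^sub>R) r ` newton_polytope F"
  then show "(\<Sum>j\<in>UNIV. co v j) \<le> r"
    by (auto simp: newton_polytope_def keys_Fbar intro: sum_coord_le_scale)
qed

lemma weight_vertex_add_eq_iff:
  "wt (vtx l + v) = wt (vtx l) + wt v \<longleftrightarrow> (\<exists>i. i \<noteq> l \<and> co v i = 0)"
  using sum_coord_add_vertex_eq_iff[of v l]
  by (simp add: weight_eq coord_vertex add.commute)

lemma euler_deriv_Fbar: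
  "euler_deriv l F = Poly_Mapping.single (vtx (Some l)) (of_nat (a l)) +
     Poly_Mapping.single (vtx None) (- (of_nat (d l) * lam))"
proof -
  have "inj vtx" by (simp add: inj_def vertex_inject)
  then have "euler_deriv l F =
      (\<Sum>j\<in>UNIV. Poly_Mapping.single (vtx j) (of_int (vtx j $ l) * coeff j))"
    by (simp add: euler_deriv_def keys_Fbar sum.reindex lookup_Fbar_vertex)
  also have "\<dots> = Poly_Mapping.single (vtx None) (- (of_nat (d l) * lam)) +
      (\<Sum>i\<in>UNIV. if i = l then Poly_Mapping.single (vtx (Some l)) (of_nat (a l)) else 0)"
    unfolding sum_option_UNIV
    by (intro arg_cong2[of _ _ _ _ "(+)"] sum.cong)
      (auto simp: vertex_def coeff_def axis_def)
  finally show ?thesis by (simp add: add.commute)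
qed

text \<open>Multiplication of a monomial by the monomial at a vertex in the graded ring.\<close>

definition vertex_mult :: "'n option \<Rightarrow> int ^ 'n \<Rightarrow> ('n, 'k) laurent" where
  "vertex_mult l v = (if \<exists>i. i \<noteq> l \<and> co v i = 0 then monom (v + vtx l) else 0)"

lemma ratio_nonzero: "\<mu> j \<noteq> 0"
  using lam_nonzero of_nat_a of_nat_d by (simp add: ratio_def split: option.split)

lemma gr_mult_euler_deriv_monom:
  "gr_mult F (euler_deriv l F) (monom v) = lscale (of_nat (a l))
     (vertex_mult (Some l) v - lscale (\<mu> (Some l)) (vertex_mult None v))"
proof -
  have vm: "(if wt (vtx j + v) = wt (vtx j) + wt v then monom (vtx j + v) else 0) = vertex_mult j v" for j
    unfolding weight_vertex_add_eq_iff vertex_mult_def by (simp only: add.commute)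
  have "gr_mult F (euler_deriv l F) (monom v) =
      lscale (of_nat (a l)) (vertex_mult (Some l) v) +
      lscale (- (of_nat (d l) * lam)) (vertex_mult None v)"
    unfolding gr_mult_eq_linear_ext euler_deriv_Fbar linear_ext_add linear_ext_single vm
      laurent.scale_one ..
  then show ?thesis
    using of_nat_a[of l] by (simp add: ratio_def laurent.scale_right_diff_distrib)
qed

text \<open>For \<open>Some l'\<close> this is a generator applied to \<open>monom v\<close>,
  divided by the unit \<open>of_nat (a l')\<close>. For \<open>None\<close> the difference is zero,
  so later arguments can treat all vertices alike.\<close>

lemma vertex_mult_diff_in_gr_jacobian:
  assumes "wt v = i - 1"
  shows "vertex_mult l v - lscale (\<mu> l) (vertex_mult None v) \<in> gr_jacobian F i"
proof (cases l)
  case None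
  then show ?thesis
    by (simp add: ratio_def laurent.subspace_0[OF subspace_gr_jacobian])
next
  case (Some l')
  have "gr_mult F (euler_deriv l' F) (monom v) \<in> gr_jacobian F i"
    by (rule gr_mult_euler_deriv_in_gr_jacobian) (use assms in \<open>simp add: gr_piece_def\<close>)
  then have "lscale (inverse (of_nat (a l'))) (gr_mult F (euler_deriv l' F) (monom v))
      \<in> gr_jacobian F i"
    using subspace_gr_jacobian laurent.subspace_scale by blast
  then show ?thesis
    using of_nat_a[of l'] Some by (simp only: gr_mult_euler_deriv_monom) simp
qed

text \<open>A lattice point \<open>v\<close> is \<open>base v\<close>, a point of a half-open fundamental box, plus the
  combination of the vertices with coefficients \<open>digit v\<close>.\<close>

definition digit :: "int ^ 'n \<Rightarrow> 'n option \<Rightarrow> nat" where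
  "digit v j = nat \<lfloor>co v j\<rfloor>"

definition base :: "int ^ 'n \<Rightarrow> int ^ 'n" where
  "base v = v - comb (\<lambda>j. int (digit v j))"

lemma base_add_comb: "base v + comb (\<lambda>j. int (digit v j)) = v"
  by (simp add: base_def)

lemma real_digit: "real (digit v j) = of_int \<lfloor>co v j\<rfloor>"
  using coord_nonneg[of v j] by (simp add: digit_def)

text \<open>Removing integer parts keeps coordinates nonnegative and zeros zero, so uniqueness of
  the coordinates applies.\<close>

lemma coord_base: "co (base v) j = frac (co v j)"
proof -
  obtain l where "co v l = 0" using coord_zero by blast
  then have "co (v + comb (\<lambda>j. - int (digit v j))) j = co v j + of_int (- int (digit v j))"
    by (intro coord_add_comb[where l = l]) (auto simp: real_digit)
  then show ?thesis by (simp add: base_def comb_uminus real_digit frac_def)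
qed

lemma coord_base_add:
  fixes m :: "'n option \<Rightarrow> nat"
  assumes "co u l = 0" "m l = 0"
  shows "co (u + comb (\<lambda>j. int (m j))) j = co u j + real (m j)"
  using coord_add_comb[where m = "\<lambda>j. int (m j)" and v = u and l = l] assms coord_nonneg[of u]
  by (simp add: add_nonneg_nonneg)

text \<open>The product of \<open>monom u\<close> with the monomials at the vertices, with multiplicities \<open>m\<close>,
  in the graded ring.\<close>

definition power_monom :: "int ^ 'n \<Rightarrow> ('n option \<Rightarrow> nat) \<Rightarrow> ('n, 'k) laurent" where
  "power_monom u m =
     (if \<exists>j. co u j = 0 \<and> m j = 0 then monom (u + comb (\<lambda>j. int (m j))) else 0)"

section \<open>Normal forms of products of vertex monomials\<close>

definition ratio_power :: "('n option \<Rightarrow> nat) \<Rightarrow> 'k" where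
  "ratio_power m = (\<Prod>j\<in>UNIV. \<mu> j ^ m j)"

definition incr :: "'n option \<Rightarrow> ('n option \<Rightarrow> nat) \<Rightarrow> 'n option \<Rightarrow> nat" where
  "incr l m = m(l := Suc (m l))"

lemma ratio_power_nonzero: "ratio_power m \<noteq> 0"
  by (simp add: ratio_power_def ratio_nonzero)

lemma ratio_power_incr: "ratio_power (incr l m) = \<mu> l * ratio_power m"
proof -
  have "\<mu> j ^ incr l m j = (if j = l then \<mu> l else 1) * \<mu> j ^ m j" for j
    by (simp add: incr_def)
  then show ?thesis by (simp add: ratio_power_def prod.distrib)
qed

lemma sum_incr: "(\<Sum>j\<in>UNIV. incr l m j) = Suc (\<Sum>j\<in>UNIV. m j)"
proof -
  have "incr l m j = m j + (if j = l then 1 else 0)" for j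
    by (simp add: incr_def)
  then show ?thesis by (simp add: sum.distrib)
qed

lemma comb_incr: "comb (\<lambda>j. int (incr l m j)) = comb (\<lambda>j. int (m j)) + vtx l"
proof -
  have "(\<lambda>j. int (incr l m j)) = (\<lambda>j. int (m j) + basis_fun l j)"
    by (auto simp: incr_def basis_fun_def)
  then show ?thesis by (simp only: comb_add comb_basis_fun)
qed

lemma vertex_mult_power_monom:
  assumes "co u j0 = 0" "m j0 = 0"
  shows "vertex_mult l (u + comb (\<lambda>j. int (m j))) = power_monom u (incr l m)"
proof -
  have "co (u + comb (\<lambda>j. int (m j))) i = 0 \<longleftrightarrow> co u i = 0 \<and> m i = 0" for i
    using coord_base_add[of u j0 m i, OF assms] coord_nonneg[of u i]
    by auto
  then have "(\<exists>i. i \<noteq> l \<and> co (u + comb (\<lambda>j. int (m j))) i = 0) \<longleftrightarrow>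
      (\<exists>i. co u i = 0 \<and> incr l m i = 0)"
    by (auto simp: incr_def)
  then show ?thesis
    by (simp only: vertex_mult_def power_monom_def comb_incr add.assoc)
qed

lemma power_monom_incr_0:
  "\<nexists>j. co u j = 0 \<and> m j = 0 \<Longrightarrow> power_monom u (incr l m) = 0"
  by (auto simp: power_monom_def incr_def)

text \<open>Modulo the ideal a product of vertex monomials is \<open>ratio_power m\<close> times a
  power of \<open>X\<^sub>0\<close>. Dividing by this scalar leaves a class that depends only on
  \<open>u\<close> and the total multiplicity.\<close>

definition normal_monom :: "int ^ 'n \<Rightarrow> ('n option \<Rightarrow> nat) \<Rightarrow> ('n, 'k) laurent" where
  "normal_monom u m = lscale (inverse (ratio_power m)) (power_monom u m)"

text \<open>The relation between \<open>X\<^sub>l\<close> and \<open>X\<^sub>0\<close> is applied to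
  the product with multiplicities \<open>m\<close> and rescaled. If that product is already zero,
  both terms vanish.\<close>

lemma normal_monom_incr_diff:
  assumes "wt u + real (\<Sum>j\<in>UNIV. m j) = i - 1"
  shows "normal_monom u (incr l m) - normal_monom u (incr None m) \<in> gr_jacobian F i"
proof (cases "\<exists>j. co u j = 0 \<and> m j = 0")
  case False
  then show ?thesis
    by (simp add: normal_monom_def power_monom_incr_0 laurent.subspace_0[OF subspace_gr_jacobian])
next
  case True
  then obtain j0 where j0: "co u j0 = 0" "m j0 = 0" by blast
  let ?v = "u + comb (\<lambda>j. int (m j))"
  have "wt ?v = i - 1"
    using assms by (simp add: weight_eq coord_base_add[of u j0 m, OF j0] sum.distrib)
  then have "lscale (inverse (\<mu> l * ratio_power m))
      (vertex_mult l ?v - lscale (\<mu> l) (vertex_mult None ?v)) \<in> gr_jacobian F i"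
    using subspace_gr_jacobian vertex_mult_diff_in_gr_jacobian laurent.subspace_scale by blast
  moreover have "\<mu> None = 1" by (simp add: ratio_def)
  moreover have "inverse (\<mu> l * ratio_power m) * \<mu> l = inverse (ratio_power m)"
    using ratio_nonzero[of l] by simp
  ultimately show ?thesis
    by (simp only: normal_monom_def vertex_mult_power_monom[of u j0 m, OF j0] ratio_power_incr
        laurent.scale_right_diff_distrib laurent.scale_scale mult_1)
qed

text \<open>Multiplicity is moved one unit at a time from a vertex \<open>Some l\<close> to
  \<open>None\<close>. Both sides end at the same power of \<open>X\<^sub>0\<close>.\<close>

lemma normal_monom_diff:
  assumes "(\<Sum>j\<in>UNIV. m j) = (\<Sum>j\<in>UNIV. m' j)" "wt u + real (\<Sum>j\<in>UNIV. m j) = i"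
  shows "normal_monom u m - normal_monom u m' \<in> gr_jacobian F i"
proof -
  have *: "normal_monom u m - normal_monom u ((\<lambda>_. 0)(None := \<Sum>j\<in>UNIV. m j)) \<in> gr_jacobian F i"
    if "wt u + real (\<Sum>j\<in>UNIV. m j) = i" for m
    using that
  proof (induction "\<Sum>l\<in>UNIV. m (Some l)" arbitrary: m)
    case 0
    then have "m = (\<lambda>_. 0)(None := \<Sum>j\<in>UNIV. m j)"
      by (auto simp: sum_option_UNIV fun_eq_iff)
    then show ?case
      using subspace_gr_jacobian by (metis diff_self laurent.subspace_0)
  next
    case (Suc n)
    then obtain l where l: "m (Some l) \<noteq> 0"
      by (metis Zero_not_Suc sum.neutral)
    define m0 where "m0 = m(Some l := m (Some l) - 1)"
    have m: "m = incr (Some l) m0"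
      using l by (auto simp: m0_def incr_def)
    have "(\<Sum>l'\<in>UNIV. m (Some l')) = Suc (\<Sum>l'\<in>UNIV. m0 (Some l'))"
      using sum_incr[of "Some l" m0] by (simp add: m sum_option_UNIV) (simp add: incr_def)
    then have n: "n = (\<Sum>l'\<in>UNIV. incr None m0 (Some l'))"
      using Suc(2) by (simp add: incr_def)
    have eq: "(\<Sum>j\<in>UNIV. incr None m0 j) = (\<Sum>j\<in>UNIV. m j)"
      by (simp add: m sum_incr)
    have "normal_monom u (incr None m0) - normal_monom u ((\<lambda>_. 0)(None := \<Sum>j\<in>UNIV. m j))
        \<in> gr_jacobian F i"
      using Suc(1)[OF n] Suc(3) unfolding eq by simp
    moreover have "normal_monom u m - normal_monom u (incr None m0) \<in> gr_jacobian F i"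
      unfolding m by (rule normal_monom_incr_diff) (use Suc(3) in \<open>simp add: m sum_incr\<close>)
    ultimately show ?case
      using subspace_gr_jacobian laurent.subspace_add by fastforce
  qed
  have "normal_monom u m' - normal_monom u ((\<lambda>_. 0)(None := \<Sum>j\<in>UNIV. m j)) \<in> gr_jacobian F i"
    using *[of m'] assms by simp
  then show ?thesis
    using *[of m] assms(2) subspace_gr_jacobian laurent.subspace_diff by fastforce
qed

end

section \<open>The monomial basis\<close>

definition initial_segment :: "('b \<Rightarrow> nat) \<Rightarrow> 'b set \<Rightarrow> nat \<Rightarrow> 'b set" where
  "initial_segment f Z s = {j \<in> Z. card {i \<in> Z. f i < f j} < s}"

lemma initial_segment_subset: "initial_segment f Z s \<subseteq> Z"
  by (auto simp: initial_segment_def)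

lemma initial_segment_down:
  assumes "finite Z" "j \<in> initial_segment f Z s" "i \<in> Z" "f i < f j"
  shows "i \<in> initial_segment f Z s"
proof -
  have "card {i' \<in> Z. f i' < f i} \<le> card {i' \<in> Z. f i' < f j}"
    using assms by (intro card_mono) auto
  then show ?thesis using assms by (auto simp: initial_segment_def)
qed

text \<open>An element of a down-closed \<open>I\<close> has fewer than \<open>card I\<close>
  elements below it, whereas an element of \<open>Z\<close> outside \<open>I\<close> has all of
  \<open>I\<close> below it.\<close>

lemma initial_segment_eqI:
  assumes "finite Z" "inj_on f Z" "I \<subseteq> Z"
    and down: "\<And>i j. i \<in> Z \<Longrightarrow> j \<in> I \<Longrightarrow> f i < f j \<Longrightarrow> i \<in> I"
  shows "initial_segment f Z (card I) = I"
proof -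
  have "finite I" using assms(1,3) finite_subset by blast
  have "card {i \<in> Z. f i < f j} < card I \<longleftrightarrow> j \<in> I" if "j \<in> Z" for j
  proof
    assume "j \<in> I"
    then have "{i \<in> Z. f i < f j} \<subseteq> I - {j}" using down by auto
    then have "{i \<in> Z. f i < f j} \<subset> I" using \<open>j \<in> I\<close> by blast
    then show "card {i \<in> Z. f i < f j} < card I"
      using \<open>finite I\<close> by (simp add: psubset_card_mono)
  next
    assume less: "card {i \<in> Z. f i < f j} < card I"
    show "j \<in> I"
    proof (rule ccontr)
      assume "j \<notin> I"
      have "I \<subseteq> {i \<in> Z. f i < f j}"
      proof
        fix i assume "i \<in> I"
        then have "i \<in> Z" "i \<noteq> j" using \<open>j \<notin> I\<close> assms(3) by auto
        then have "f i \<noteq> f j" using inj_on_eq_iff[OF assms(2)] that by simp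
        moreover have "\<not> f j < f i" using down[OF that \<open>i \<in> I\<close>] \<open>j \<notin> I\<close> by blast
        ultimately show "i \<in> {i \<in> Z. f i < f j}" using \<open>i \<in> Z\<close> by simp
      qed
      then have "card I \<le> card {i \<in> Z. f i < f j}"
        using assms(1) by (intro card_mono) simp_all
      then show False using less by simp
    qed
  qed
  then show ?thesis using assms(3) by (auto simp: initial_segment_def)
qed

text \<open>The rank \<open>r\<close> is a bijection from \<open>Z\<close> onto the first
  \<open>card Z\<close> naturals, and the segment consists of the elements of rank below
  \<open>s\<close>.\<close>

lemma card_initial_segment:
  assumes "finite Z" "inj_on f Z"
  shows "card (initial_segment f Z s) = min s (card Z)"
proof -
  define r where "r j = card {i \<in> Z. f i < f j}" for j
  have mono: "r i < r j" if "i \<in> Z" "j \<in> Z" "f i < f j" for i j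
  proof -
    have "{i' \<in> Z. f i' < f i} \<subseteq> {i' \<in> Z. f i' < f j} - {i}" "i \<in> {i' \<in> Z. f i' < f j}"
      using that by auto
    then have "{i' \<in> Z. f i' < f i} \<subset> {i' \<in> Z. f i' < f j}" by blast
    then show ?thesis unfolding r_def using assms(1) by (intro psubset_card_mono) simp_all
  qed
  have inj: "inj_on r Z"
  proof (rule inj_onI)
    fix i j assume ij: "i \<in> Z" "j \<in> Z" "r i = r j"
    then have "\<not> f i < f j" "\<not> f j < f i" using mono[of i j] mono[of j i] by auto
    then have "f i = f j" by simp
    then show "i = j" using inj_on_eq_iff[OF assms(2)] ij by simp
  qed
  have "r j < card Z" if "j \<in> Z" for j
  proof -
    have "{i \<in> Z. f i < f j} \<subset> Z" using that by blast
    then show ?thesis unfolding r_def using assms(1) by (rule psubset_card_mono[rotated])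
  qed
  then have "r ` Z \<subseteq> {..<card Z}" by auto
  then have img: "r ` Z = {..<card Z}"
    using inj by (intro card_subset_eq) (auto simp: card_image)
  have "r ` initial_segment f Z s = r ` Z \<inter> {..<s}"
    by (auto simp: initial_segment_def r_def)
  also have "\<dots> = {..<min s (card Z)}" unfolding img by auto
  finally have "card (r ` initial_segment f Z s) = min s (card Z)" by simp
  moreover have "inj_on r (initial_segment f Z s)"
    using inj initial_segment_subset by (rule inj_on_subset)
  ultimately show ?thesis by (simp add: card_image)
qed

lemma initial_segment_all:
  assumes "finite Z" "inj_on f Z" "card Z \<le> s"
  shows "initial_segment f Z s = Z"
  using assms card_initial_segment[of Z f s]
  by (intro card_subset_eq initial_segment_subset) auto

text \<open>With \<open>None\<close> as the last vertex, the bounds \<open>- d i < v $ i \<le> a i\<close> in \<open>Bset a d\<close> are the instances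
  of the pair conditions for the pairs \<open>(Some i, None)\<close>.\<close>

definition position :: "'n::{finite,linorder} option \<Rightarrow> nat" where
  "position j = (case j of None \<Rightarrow> CARD('n) | Some i \<Rightarrow> card {i'. i' < i})"

lemma position_Some_less_None: "position (Some i) < position (None :: 'n option)"
  for i :: "'n::{finite,linorder}"
proof -
  have "{i'. i' < i} \<subset> UNIV" by auto
  from psubset_card_mono[OF finite this] show ?thesis by (simp add: position_def)
qed

lemma position_Some_less_iff:
  "position (Some i) < position (Some j) \<longleftrightarrow> i < (j :: 'n::{finite,linorder})"
proof -
  have *: "card {i'. i' < i} < card {i'. i' < j}" if "i < j" for i j :: 'n
    using that by (intro psubset_card_mono) auto
  show ?thesis using *[of i j] *[of j i] by (cases i j rule: linorder_cases) (auto simp: position_def)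
qed

lemma inj_position: "inj (position :: 'n::{finite,linorder} option \<Rightarrow> nat)"
proof (rule injI)
  fix i j :: "'n option"
  assume eq: "position i = position j"
  then have "\<not> position i < position j" "\<not> position j < position i" by simp_all
  then show "i = j"
    by (cases i; cases j) (simp_all add: position_Some_less_None position_Some_less_iff)
qed

lemma position_pairs:
  "(\<forall>i j. position i < position (j :: 'n::{finite,linorder} option) \<longrightarrow> P i j) \<longleftrightarrow>
   (\<forall>i. P (Some i) None) \<and> (\<forall>i j. i < j \<longrightarrow> P (Some i) (Some j))"
    (is "?L \<longleftrightarrow> ?R")
proof
  assume ?L
  then show ?R using position_Some_less_None position_Some_less_iff by blast
next
  assume R: ?R
  show ?L
  proof (intro allI impI)
    fix i j :: "'n option"
    assume less: "position i < position j"
    then obtain i' where "i = Some i'"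
      using position_Some_less_None by (cases i; cases j) (auto dest: less_asym)
    then show "P i j"
      using R less by (cases j) (simp_all add: position_Some_less_iff)
  qed
qed

locale ordered_laurent_simplex = laurent_simplex a d lam
  for a d :: "'n::{finite,linorder} \<Rightarrow> nat" and lam :: "'k::field"
begin

section \<open>\<open>Bset a d\<close> in terms of the simplex coordinates\<close>

lemma Bset_iff_slopes:
  "v \<in> Bset a d \<longleftrightarrow> (\<forall>i j. position i < position j \<longrightarrow>
     \<rho> i * (slope d (real_vec v) i - slope d (real_vec v) j) \<le> 1 \<and>
     \<rho> j * (slope d (real_vec v) j - slope d (real_vec v) i) < 1)"
proof -
  \<comment> \<open>Facts 1 and 2 express the box bounds as pairs with \<open>None\<close>, which
    has slope 0 and coefficient 1; facts 3 and 4 treat pairs of variables.\<close>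
  have 1: "\<rho> (Some i) * (slope d (real_vec v) (Some i) - slope d (real_vec v) None) \<le> 1 \<longleftrightarrow>
      v $ i \<le> int (a i)" for i
    using a_pos[of i] d_pos[of i]
    by (simp add: relation_coeff_def slope_def real_vec_def field_simps) linarith
  have 2: "\<rho> None * (slope d (real_vec v) None - slope d (real_vec v) (Some i)) < 1 \<longleftrightarrow>
      - int (d i) < v $ i" for i
    using a_pos[of i] d_pos[of i]
    by (simp add: relation_coeff_def slope_def real_vec_def field_simps) linarith
  have diff: "\<rho> (Some i) * (slope d (real_vec v) (Some i) - slope d (real_vec v) (Some j)) =
      (real_of_int (v $ i) - real (d i) * real_of_int (v $ j) / real (d j)) / real (a i)" for i j
    using d_pos[of i]
    by (simp add: relation_coeff_def slope_def real_vec_def right_diff_distrib diff_divide_distrib)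
  have 3: "\<rho> (Some i) * (slope d (real_vec v) (Some i) - slope d (real_vec v) (Some j)) \<le> 1 \<longleftrightarrow>
      real (d j) / real (d i) * (real_of_int (v $ i) - real (a i)) \<le> real_of_int (v $ j)" for i j
    unfolding diff using a_pos[of i] d_pos[of i] d_pos[of j] by (simp add: field_simps)
  have 4: "\<rho> (Some j) * (slope d (real_vec v) (Some j) - slope d (real_vec v) (Some i)) < 1 \<longleftrightarrow>
      real_of_int (v $ j) < real (d j) / real (d i) * real_of_int (v $ i) + real (a j)" for i j
    unfolding diff using a_pos[of j] d_pos[of i] d_pos[of j] by (simp add: field_simps)
  show ?thesis
    unfolding position_pairs 1 2 3 4 by (auto simp: Bset_def)
qed

text \<open>The expression \<open>\<rho> j * (t j - t i)\<close>, with \<open>t\<close> the slope,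
  is at most \<open>co v j\<close>, with equality when \<open>i\<close> has coordinate zero. So the
  pair conditions bound coordinates by 1, and their strict halves decide when the value 1 is
  allowed.\<close>

lemma Bset_iff_coord:
  "v \<in> Bset a d \<longleftrightarrow>
     (\<forall>j. co v j \<le> 1 \<and> (co v j = 1 \<longrightarrow> (\<forall>i. co v i = 0 \<longrightarrow> position j < position i)))"
    (is "_ \<longleftrightarrow> ?R")
proof
  let ?t = "slope d (real_vec v)"
  assume "v \<in> Bset a d"
  then have B: "\<rho> i * (?t i - ?t j) \<le> 1" "\<rho> j * (?t j - ?t i) < 1" if "position i < position j" for i j
    using that by (auto simp: Bset_iff_slopes)
  have co: "co v j = \<rho> j * (?t j - ?t i)" if "co v i = 0" for i j
    using that relation_coeff_pos[of i] by (simp add: coord_def)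
  have neq: "position i \<noteq> position j" if "i \<noteq> j" for i j :: "'n option"
    using inj_position that by (meson injD)
  show ?R
  proof (intro allI conjI impI)
    fix j
    obtain l where l: "co v l = 0" using coord_zero by blast
    show "co v j \<le> 1"
    proof (cases "l = j")
      case False
      then show ?thesis
        using co[OF l, of j] B(1)[of j l] B(2)[of l j] neq[OF False] by fastforce
    qed (use l in simp)
  next
    fix j i assume "co v j = 1" "co v i = 0"
    then have "i \<noteq> j" by auto
    then show "position j < position i"
      using co[OF \<open>co v i = 0\<close>, of j] B(2)[of i j] neq[OF \<open>i \<noteq> j\<close>] \<open>co v j = 1\<close> by fastforce
  qed
next
  let ?t = "slope d (real_vec v)"
  assume R: ?R
  have le: "\<rho> i * (?t i - ?t j) \<le> co v i" for i j
    using relation_coeff_pos[of i]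
    by (simp add: coord_def min_slope_def)
  show "v \<in> Bset a d"
    unfolding Bset_iff_slopes
  proof (intro allI impI conjI)
    fix i j :: "'n option" assume less: "position i < position j"
    show "\<rho> i * (?t i - ?t j) \<le> 1" using le[of i j] R by (meson order_trans)
    \<comment> \<open>The value 1 would force \<open>co v j = 1\<close> and make \<open>i\<close> a
      vertex of minimal slope, hence of coordinate zero; then \<open>j\<close> would have to precede
      \<open>i\<close>.\<close>
    have "\<rho> j * (?t j - ?t i) \<noteq> 1"
    proof
      assume eq: "\<rho> j * (?t j - ?t i) = 1"
      then have j1: "co v j = 1" using le[of j i] R by (simp add: order_antisym)
      then have "\<rho> j * (?t j - min_slope d v) = \<rho> j * (?t j - ?t i)"
        using eq by (simp add: coord_def)
      then have "co v i = 0"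
        using relation_coeff_pos[of j] by (simp add: coord_def)
      then show False using j1 R less by fastforce
    qed
    then show "\<rho> j * (?t j - ?t i) < 1" using le[of j i] R by (smt (verit))
  qed
qed

section \<open>The projection onto the standard monomials\<close>

definition indicator_fun :: "'n option set \<Rightarrow> 'n option \<Rightarrow> nat" where
  "indicator_fun I j = (if j \<in> I then 1 else 0)"

definition zero_set :: "(int, 'n) vec \<Rightarrow> 'n option set" where
  "zero_set u = {j. co u j = 0}"

text \<open>For a base point \<open>u\<close> this represents the class of
  \<open>X\<^sub>0 ^ s\<close> over \<open>u\<close> by a multiple of a monomial with exponent in
  \<open>Bset a d\<close>, or by zero.\<close>

definition standard_monom :: "(int, 'n) vec \<Rightarrow> nat \<Rightarrow> ('n, 'k) laurent" where
  "standard_monom u s =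
     normal_monom u (indicator_fun (initial_segment position (zero_set u) s))"

text \<open>The projection of the graded ring onto the span of the monomials with exponent in
  \<open>Bset a d\<close> along the Jacobian ideal.\<close>

definition reduce :: "('n, 'k) laurent \<Rightarrow> ('n, 'k) laurent" where
  "reduce = linear_ext (\<lambda>v. lscale (ratio_power (digit v))
     (standard_monom (base v) (\<Sum>j\<in>UNIV. digit v j)))"

lemma inj_on_position: "inj_on position (A :: 'n option set)"
  using inj_position by (rule inj_on_subset) simp

lemma sum_indicator_fun: "(\<Sum>j\<in>UNIV. indicator_fun I j) = card I"
  by (simp add: indicator_fun_def flip: sum.inter_filter)

text \<open>The segment is then the whole zero set, so no coordinate stays zero and the product
  vanishes in the graded ring.\<close>

lemma standard_monom_eq_0:
  assumes "card (zero_set u) \<le> s"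
  shows "standard_monom u s = 0"
proof -
  have "initial_segment position (zero_set u) s = zero_set u"
    using assms by (intro initial_segment_all inj_on_position) auto
  then show ?thesis
    by (simp add: standard_monom_def normal_monom_def power_monom_def indicator_fun_def zero_set_def)
qed

text \<open>A nonzero product keeps the base and raises the digit at \<open>l\<close>. If the
  product is zero, every zero of the base other than \<open>l\<close> has a positive digit, so the
  raised degree reaches \<open>card (zero_set (base v))\<close> and the right side vanishes
  too.\<close>

lemma reduce_vertex_mult:
  "reduce (vertex_mult l v) = lscale (\<mu> l * ratio_power (digit v))
     (standard_monom (base v) (Suc (\<Sum>j\<in>UNIV. digit v j)))"
proof (cases "\<exists>i. i \<noteq> l \<and> co v i = 0")
  case True
  then have "co (v + vtx l) j = co v j + (if j = l then 1 else 0)" for j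
    using coord_add_vertex by blast
  then have digit: "digit (v + vtx l) = incr l (digit v)"
    using coord_nonneg[of v l]
    by (auto simp: digit_def incr_def fun_eq_iff nat_add_distrib)
  then have "base (v + vtx l) = base v"
    by (simp add: base_def comb_incr)
  then show ?thesis
    using True by (simp add: vertex_mult_def reduce_def digit ratio_power_incr sum_incr)
next
  case False
  have "card (zero_set (base v)) \<le> Suc (card (zero_set (base v) - {l}))"
    by (cases "l \<in> zero_set (base v)") (simp_all add: card_Suc_Diff1 del: card_Diff_insert)
  also have "card (zero_set (base v) - {l}) \<le> (\<Sum>j\<in>zero_set (base v) - {l}. digit v j)"
  proof -
    have "digit v j \<ge> 1" if "j \<in> zero_set (base v) - {l}" for j
    proof -
      have "frac (co v j) = 0" "co v j \<noteq> 0"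
        using that False by (auto simp: zero_set_def coord_base)
      then have "digit v j \<noteq> 0"
        using real_digit[of v j] by (auto simp: frac_def)
      then show ?thesis by simp
    qed
    then have "(\<Sum>j\<in>zero_set (base v) - {l}. 1) \<le> (\<Sum>j\<in>zero_set (base v) - {l}. digit v j)"
      by (intro sum_mono)
    then show ?thesis by simp
  qed
  also have "\<dots> \<le> (\<Sum>j\<in>UNIV. digit v j)" by (intro sum_mono2) auto
  finally have "standard_monom (base v) (Suc (\<Sum>j\<in>UNIV. digit v j)) = 0"
    by (intro standard_monom_eq_0) simp
  moreover have "vertex_mult l v = 0"
    unfolding vertex_mult_def using False by (rule if_not_P)
  ultimately show ?thesis by (simp add: reduce_def)
qed

lemma linear_reduce: "Vector_Spaces.linear lscale lscale reduce"
  unfolding reduce_def by (rule linear_linear_ext)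

text \<open>On a monomial both terms of the relation reduce to the same multiple of one standard
  monomial, since \<open>reduce_vertex_mult\<close> involves \<open>l\<close> only through the
  factor \<open>\<mu> l\<close>.\<close>

lemma reduce_gr_mult_euler_deriv: "reduce (gr_mult F (euler_deriv l F) g) = 0"
proof -
  interpret r: Vector_Spaces.linear lscale lscale reduce by (rule linear_reduce)
  define L where "L h = reduce (gr_mult F (euler_deriv l F) h)" for h
  have "Vector_Spaces.linear lscale lscale L"
    unfolding Vector_Spaces.linear_iff L_def gr_mult_add_right gr_mult_scale_right r.add r.scale
    using laurent.vector_space_axioms by blast
  moreover have "L (monom v) = 0" for v
    by (simp add: L_def gr_mult_euler_deriv_monom r.scale r.diff reduce_vertex_mult)
      (simp add: ratio_def)
  ultimately have "L g = linear_ext (\<lambda>_. 0) g"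
    using linear_eq_linear_ext[of L g] by simp
  then show ?thesis by (simp add: L_def linear_ext_def)
qed

lemma reduce_gr_jacobian: "y \<in> gr_jacobian F i \<Longrightarrow> reduce y = 0"
proof -
  interpret r: Vector_Spaces.linear lscale lscale reduce by (rule linear_reduce)
  show "y \<in> gr_jacobian F i \<Longrightarrow> reduce y = 0"
    by (auto simp: gr_jacobian_def r.sum reduce_gr_mult_euler_deriv)
qed

lemma power_monom_digit: "power_monom (base v) (digit v) = monom v"
proof -
  obtain l where l: "co v l = 0" using coord_zero by blast
  then have "co (base v) l = 0" "digit v l = 0" by (simp_all add: coord_base digit_def)
  then show ?thesis
    unfolding power_monom_def base_add_comb by auto
qed

lemma monom_eq_normal_monom:
  "monom v = lscale (ratio_power (digit v)) (normal_monom (base v) (digit v))"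
  by (simp add: normal_monom_def power_monom_digit ratio_power_nonzero)

text \<open>The zeros of \<open>base b\<close> are the places where \<open>b\<close> has coordinate
  0 or 1, and the ones come first in the order of positions. They form the initial segment used by
  \<open>standard_monom\<close>, so \<open>b\<close> is its own normal form.\<close>

lemma reduce_monom_Bset:
  assumes "b \<in> Bset a d"
  shows "reduce (monom b) = monom b"
proof -
  define I where "I = {j. co b j = 1}"
  have B: "co b j \<le> 1" "co b j = 1 \<Longrightarrow> co b i = 0 \<Longrightarrow> position j < position i" for i j
    using assms by (auto simp: Bset_iff_coord)
  have digit: "digit b = indicator_fun I"
  proof
    fix j
    have "\<lfloor>co b j\<rfloor> = (if co b j = 1 then 1 else 0)"
      using B(1)[of j] coord_nonneg[of b j] by (auto simp: floor_eq_iff)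
    then show "digit b j = indicator_fun I j"
      by (simp add: digit_def indicator_fun_def I_def)
  qed
  have Z: "zero_set (base b) = {j. co b j = 0 \<or> co b j = 1}"
  proof -
    have "frac (co b j) = 0 \<longleftrightarrow> co b j = 0 \<or> co b j = 1" for j
      using B(1)[of j] coord_nonneg[of b j] by (cases "co b j = 1") (auto simp: frac_eq)
    then show ?thesis by (simp add: zero_set_def coord_base)
  qed
  have "initial_segment position (zero_set (base b)) (card I) = I"
  proof (rule initial_segment_eqI)
    fix i j assume "i \<in> zero_set (base b)" "j \<in> I" "position i < position j"
    then show "i \<in> I" using B(2)[of j i] by (auto simp: Z I_def)
  qed (auto simp: Z I_def inj_on_position)
  then have "standard_monom (base b) (card I) = normal_monom (base b) (digit b)"
    by (simp add: standard_monom_def digit)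
  then have "reduce (monom b) = lscale (ratio_power (digit b)) (normal_monom (base b) (digit b))"
    by (simp add: reduce_def digit sum_indicator_fun)
  then show ?thesis by (simp only: monom_eq_normal_monom[symmetric])
qed

lemma weight_base: "wt (base v) + real (\<Sum>j\<in>UNIV. digit v j) = wt v"
  by (simp add: weight_eq coord_base frac_def real_digit sum_subtractf)

text \<open>Up to a common scalar, both terms are normal monomials over one base with one total
  multiplicity.\<close>

lemma monom_diff_reduce_in_gr_jacobian: "monom v - reduce (monom v) \<in> gr_jacobian F (wt v)"
proof -
  let ?u = "base v" and ?s = "\<Sum>j\<in>UNIV. digit v j"
  let ?Z = "zero_set ?u"
  let ?I = "initial_segment position ?Z ?s"
  have "\<exists>m. (\<Sum>j\<in>UNIV. m j) = ?s \<and> normal_monom ?u m = standard_monom ?u ?s"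
  proof (cases "?s \<le> card ?Z")
    case True
    then have "card ?I = ?s"
      using card_initial_segment[OF _ inj_on_position, of ?Z ?s] by simp
    then show ?thesis
      by (intro exI[of _ "indicator_fun ?I"]) (simp add: sum_indicator_fun standard_monom_def)
  next
    case False
    \<comment> \<open>The segment has only \<open>card ?Z\<close> elements, so the surplus is put at
      \<open>None\<close> to reach total \<open>?s\<close>. Every zero of the base is filled, so the
      product vanishes like the standard monomial.\<close>
    define m where "m j = indicator_fun ?Z j + (if j = None then ?s - card ?Z else 0)" for j
    have "(\<Sum>j\<in>UNIV. m j) = ?s"
      using False unfolding m_def sum.distrib sum_indicator_fun by simp
    moreover have "normal_monom ?u m = 0"
      by (simp add: normal_monom_def power_monom_def m_def indicator_fun_def zero_set_def)
    moreover have "standard_monom ?u ?s = 0"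
      using False by (intro standard_monom_eq_0) simp
    ultimately show ?thesis by auto
  qed
  then obtain m where "(\<Sum>j\<in>UNIV. m j) = ?s" "normal_monom ?u m = standard_monom ?u ?s"
    by blast
  then have "normal_monom ?u (digit v) - standard_monom ?u ?s \<in> gr_jacobian F (wt v)"
    using normal_monom_diff[of "digit v" m ?u "wt v"] weight_base by simp
  then have "lscale (ratio_power (digit v)) (normal_monom ?u (digit v) - standard_monom ?u ?s)
      \<in> gr_jacobian F (wt v)"
    by (intro laurent.subspace_scale subspace_gr_jacobian)
  then show ?thesis
    by (subst (1) monom_eq_normal_monom) (simp add: reduce_def laurent.scale_right_diff_distrib)
qed

text \<open>A nonzero standard monomial has coordinate 1 exactly on an initial segment of the zero
  set and fractional coordinates off that set, which is the criterion of
  \<open>Bset_iff_coord\<close>.\<close>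

lemma reduce_monom_in_span: "reduce (monom v) \<in> laurent.span (monom ` {b \<in> Bset a d. wt b = wt v})"
proof -
  let ?u = "base v" and ?s = "\<Sum>j\<in>UNIV. digit v j"
  let ?Z = "zero_set ?u"
  define I where "I = initial_segment position ?Z ?s"
  let ?m = "indicator_fun I"
  have "power_monom ?u ?m \<in> laurent.span (monom ` {b \<in> Bset a d. wt b = wt v})"
  proof (cases "\<exists>j. co ?u j = 0 \<and> ?m j = 0")
    case True
    then obtain j0 where j0: "co ?u j0 = 0" "?m j0 = 0" by blast
    define b where "b = ?u + comb (\<lambda>j. int (?m j))"
    have I_Z: "I \<subseteq> ?Z" unfolding I_def by (rule initial_segment_subset)
    have co: "co b j = co ?u j + real (?m j)" for j
      unfolding b_def by (rule coord_base_add[of ?u j0 ?m, OF j0])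
    have lt1: "co ?u j < 1" for j by (simp add: coord_base frac_lt_1)
    have one: "co b j = 1 \<longleftrightarrow> j \<in> I" for j
      using lt1[of j] I_Z by (auto simp: co indicator_fun_def zero_set_def)
    have zero: "co b j = 0 \<longleftrightarrow> j \<in> ?Z - I" for j
      using coord_nonneg[of ?u j] by (auto simp: co indicator_fun_def zero_set_def)
    have "co b j \<le> 1" for j
      using lt1[of j] I_Z by (auto simp: co indicator_fun_def zero_set_def)
    moreover have "position j < position i" if "j \<in> I" "i \<in> ?Z - I" for i j
    proof -
      have "\<not> position i < position j"
        using initial_segment_down[of ?Z j position ?s i] that by (auto simp: I_def)
      moreover have "position i \<noteq> position j"
        using that inj_position by (metis DiffE injD)
      ultimately show ?thesis by simp
    qed
    ultimately have "b \<in> Bset a d"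
      unfolding Bset_iff_coord one zero by blast
    \<comment> \<open>A zero left over means that the segment is proper, so it was not truncated and
      the degree is preserved.\<close>
    moreover have "card I = ?s"
    proof -
      have "j0 \<in> ?Z - I" using j0 by (auto simp: zero_set_def indicator_fun_def split: if_splits)
      then have "I \<noteq> ?Z" by blast
      then have "\<not> card ?Z \<le> ?s"
        unfolding I_def using initial_segment_all[OF _ inj_on_position, of ?Z ?s] by auto
      then show ?thesis
        unfolding I_def using card_initial_segment[OF _ inj_on_position, of ?Z ?s] by simp
    qed
    then have "wt b = wt v"
      using weight_base[of v] sum_indicator_fun[of I]
      by (simp add: weight_eq co sum.distrib flip: of_nat_sum)
    moreover have "power_monom ?u ?m = monom b"
      using True by (simp only: power_monom_def b_def if_True)
    ultimately show ?thesis by (auto intro: laurent.span_base)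
  next
    case False
    then show ?thesis by (simp only: power_monom_def if_False laurent.span_zero)
  qed
  then show ?thesis
    by (simp add: reduce_def standard_monom_def normal_monom_def I_def laurent.span_scale
        del: laurent.scale_scale)
qed

text \<open>The monomials over \<open>Bset a d\<close> span a second complement \<open>?W\<close> of
  the Jacobian piece, and \<open>reduce\<close> compares it with \<open>V\<close>.\<close>

theorem dim_monomial_complement:
  assumes "monomial_complement F i V"
  shows "laurent.dim V = card {v \<in> Bset a d. wt v = i}"
proof -
  let ?B = "{v \<in> Bset a d. wt v = i}"
  let ?W = "laurent.span (monom ` ?B) :: ('n, 'k) laurent set"
  let ?J = "gr_jacobian F i"
  have V: "laurent.subspace V" "V \<inter> ?J = {0}" and sums: "gr_piece F i = {x + y | x y. x \<in> V \<and> y \<in> ?J}"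
    using assms by (auto simp: monomial_complement_def)
  \<comment> \<open>The containment is read off the assumed decomposition by taking the component in
    \<open>V\<close> to be zero.\<close>
  have J_le: "?J \<subseteq> gr_piece F i"
  proof
    fix y assume "y \<in> ?J"
    then show "y \<in> gr_piece F i"
      unfolding sums using laurent.subspace_0[OF V(1)]
      by (intro CollectI exI[of _ 0] exI[of _ y]) simp
  qed
  have W_le: "?W \<subseteq> gr_piece F i"
    unfolding gr_piece_eq_span by (intro laurent.span_mono) auto
  have "{x + y | x y. x \<in> ?W \<and> y \<in> ?J} = gr_piece F i"
  proof (intro equalityI subsetI)
    fix h assume h: "h \<in> gr_piece F i"
    have "reduce h \<in> ?W"
      using linear_eq_linear_ext[OF linear_reduce, of h] h reduce_monom_in_span
      by (auto simp: gr_piece_def intro!: linear_ext_mem_subspace)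
    moreover have "h - reduce h \<in> ?J"
    proof -
      have "h - reduce h = linear_ext (\<lambda>v. monom v - reduce (monom v)) h"
        using linear_eq_linear_ext[OF linear_reduce, of h] linear_ext_monom[of h]
        by (simp add: linear_ext_def laurent.scale_right_diff_distrib sum_subtractf)
      also have "\<dots> \<in> ?J"
        using h monom_diff_reduce_in_gr_jacobian
        by (auto simp: gr_piece_def intro!: linear_ext_mem_subspace subspace_gr_jacobian)
      finally show ?thesis .
    qed
    moreover have "h = reduce h + (h - reduce h)" by simp
    ultimately show "h \<in> {x + y | x y. x \<in> ?W \<and> y \<in> ?J}" by blast
  next
    fix h assume "h \<in> {x + y | x y. x \<in> ?W \<and> y \<in> ?J}"
    then show "h \<in> gr_piece F i"
      using J_le W_le laurent.subspace_add[OF subspace_gr_piece] by blast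
  qed
  moreover have "reduce x = x" if "x \<in> ?W" for x
  proof -
    have "reduce x = linear_ext monom x"
      unfolding linear_eq_linear_ext[OF linear_reduce, of x] linear_ext_def
      using that reduce_monom_Bset by (intro sum.cong) (auto simp: monomial_span_mem_iff)
    then show ?thesis by (simp only: linear_ext_monom)
  qed
  ultimately have "laurent.dim V = laurent.dim ?W"
    using V sums reduce_gr_jacobian
    by (intro laurent.dim_complement_eq[OF linear_reduce, of V ?W ?J])
      (auto simp: subspace_gr_jacobian)
  then show ?thesis by (simp only: dim_monomial_span)
qed

end

section \<open>Integers as units of the finite coefficient field\<close>

lemma of_nat_card_UNIV: "of_nat (CARD('k)) = (0 :: 'k::{comm_ring_1,finite})"
proof -
  \<comment> \<open>Translation by 1 permutes the ring, so the added ones must sum to zero.\<close>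
  have "(\<Sum>x\<in>UNIV. x :: 'k) = (\<Sum>x\<in>UNIV. x + 1)"
    by (rule sum.reindex_bij_witness[of _ "\<lambda>x. x + 1" "\<lambda>x. x - 1"]) auto
  then show ?thesis by (simp add: sum.distrib)
qed

lemma of_nat_neq_0_if_coprime_card:
  assumes "coprime n (CARD('k))"
  shows "of_nat n \<noteq> (0 :: 'k::{field,finite})"
proof
  assume n: "of_nat n = (0 :: 'k)"
  have "coprime (int n) (int (CARD('k)))" using assms by simp
  \<comment> \<open>A Bezout combination equal to 1 would map to 0 in the field.\<close>
  then obtain x y where "x * int n + y * int (CARD('k)) = 1"
    by (metis bezout_int coprime_imp_gcd_eq_1)
  then have "of_int (x * int n + y * int (CARD('k))) = (1 :: 'k)" by simp
  then show False by (simp add: n of_nat_card_UNIV)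
qed

theorem corollary1p3:
  fixes p q :: nat
    and a d :: "'n::{finite,linorder} \<Rightarrow> nat"
    and lam :: "'k::{field,finite}"
    and V :: "nat \<Rightarrow> ('n, 'k) laurent set"
    and k :: "nat \<Rightarrow> nat"
  assumes "prime p" and "p > 2"
    and "\<exists>r\<ge>1. q = p ^ r" and "CARD('k) = q"
    and "\<And>i. a i > 0" and "\<And>i. \<not> p dvd a i"
    and "\<And>i. d i > 0" and "\<And>i. \<not> p dvd d i"
    and "lam \<noteq> 0"
    and "\<And>m. monomial_complement (Fbar a d lam) (real m / real (estar a d)) (V m)"
    and "\<And>i. k i = card {v \<in> Bset a d. weight (Fbar a d lam) v = real i / real (estar a d)}"
  shows "hodge_polygon (estar a d) V =
    lower_convex_polygon
      (insert (0, 0)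
        ((\<lambda>m. (\<Sum>i\<le>m. real (k i), \<Sum>i\<le>m. real i * real (k i) / real (estar a d)))
          ` {..CARD('n) * estar a d}))"
proof -
  have nz: "of_nat n \<noteq> (0 :: 'k)" if "\<not> p dvd n" for n
  proof -
    have "coprime p n" using that \<open>prime p\<close> by (simp add: prime_imp_coprime)
    then have "coprime n (CARD('k))" using assms(3,4) by (auto simp: ac_simps)
    then show ?thesis by (rule of_nat_neq_0_if_coprime_card)
  qed
  interpret ordered_laurent_simplex a d lam
    by unfold_locales (use assms nz in auto)
  \<comment> \<open>Agreement in every degree makes the two polygons arise from the same set of
    points.\<close>
  have "hodge_number V m = k m" for m
    using dim_monomial_complement assms(10,11) by (simp add: hodge_number_def)
  then show ?thesis by (simp add: hodge_polygon_def)
qed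

end
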